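(* For every positive integer $c$, there exists a graph $G$ of pathwidth $2$ that has no anagram-free vertex $c$-colouring.
   Context: A string $s_1,\ldots,s_{2r}$ (with $r\ge 1$) is \emph{anagramish} if its first half $s_1,\ldots,s_r$ is a permutation of its second half $s_{r+1},\ldots,s_{2r}$. For a graph $G$, a vertex $c$-colouring $\phi:V(G)\to\{1,\ldots,c\}$ is \emph{anagram-free} if there is no path $v_1,\ldots,v_{2r}$ in $G$ ($r\ge1$) such that the string $\phi(v_1),\ldots,\phi(v_{2r})$ is anagramish. *)

theory Defs
  imports
    "HOL-Library.Multiset"
    "HOL-Library.FuncSet"
    "Graph_Theory.Graph_Theory"
begin

(* Undirected simple graphs are loop-free symmetric digraphs without parallel arcs, as in
   the locales graph and pair_graph. *)

(* The interpolation condition says that the bags containing a given vertex are consecutive. *)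
definition path_decomposition :: "('a, 'b) pre_digraph \<Rightarrow> 'a set list \<Rightarrow> bool" where
  "path_decomposition G Bs \<longleftrightarrow>
     Bs \<noteq> [] \<and>
     \<Union> (set Bs) = verts G \<and>
     (\<forall>(u, v) \<in> arcs_ends G. \<exists>B \<in> set Bs. u \<in> B \<and> v \<in> B) \<and>
     (\<forall>i j k. i \<le> j \<and> j \<le> k \<and> k < length Bs \<longrightarrow> Bs ! i \<inter> Bs ! k \<subseteq> Bs ! j)"

(* Truncated subtraction only matters for the graph without vertices, which gets pathwidth 0. *)
definition decomposition_width :: "'a set list \<Rightarrow> nat" where
  "decomposition_width Bs = Max (card ` set Bs) - 1"

(* Only meaningful for finite G, because card is 0 on infinite bags. *)
definition pathwidth :: "('a, 'b) pre_digraph \<Rightarrow> nat" where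
  "pathwidth G = (LEAST w. \<exists>Bs. path_decomposition G Bs \<and> decomposition_width Bs = w)"

lemma path_decomposition_trivial:
  assumes "wf_digraph G"
  shows "path_decomposition G [verts G]"
  using wf_digraph.adj_in_verts[OF assms] by (auto simp: path_decomposition_def)

lemma pathwidth_attained:
  assumes "wf_digraph G"
  shows "\<exists>Bs. path_decomposition G Bs \<and> decomposition_width Bs = pathwidth G"
  unfolding pathwidth_def
  by (rule LeastI_ex) (use path_decomposition_trivial[OF assms] in blast)

lemma pathwidth_le:
  assumes "path_decomposition G Bs"
  shows "pathwidth G \<le> decomposition_width Bs"
  unfolding pathwidth_def by (rule Least_le) (use assms in blast)

definition anagramish :: "'a list \<Rightarrow> bool" where
  "anagramish s \<longleftrightarrow>
     (\<exists>r \<ge> 1. length s = 2 * r \<and> mset (take r s) = mset (drop r s))"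

definition anagram_free_colouring :: "('a, 'b) pre_digraph \<Rightarrow> nat \<Rightarrow> ('a \<Rightarrow> nat) \<Rightarrow> bool" where
  "anagram_free_colouring G c \<phi> \<longleftrightarrow>
     \<phi> \<in> verts G \<rightarrow> {1..c} \<and> \<not> (\<exists>p. vpath p G \<and> anagramish (map \<phi> p))"

end

theory Submission
  imports Defs Complex_Main
begin

text \<open>
  The graph is the square of a path: its monotone paths are the intervals from which pairwise
  non-adjacent vertices have been deleted. It is therefore enough to find, in every long word over
  \<open>c\<close> letters, two adjacent intervals that become anagrams of each other after few deletions.
  By induction on \<open>c\<close>, every window of some length \<open>L\<close> contains all letters, so each letter has
  density at least \<open>1 / L\<close>. If the two halves of a dyadic interval have different letter densities,
  the mean sum of squared densities on the halves exceeds the one on the whole; it is at most 1, so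
  some two adjacent intervals have letter counts that differ by much less than \<open>1 / L\<close> times their
  length, and the surplus letters can be deleted at non-adjacent places.
\<close>

section \<open>Counting letters on sets of positions\<close>

text \<open>Counting over arbitrary sets of positions, not factors of a list, makes deletion a set
  difference and leaves the remaining indices unchanged.\<close>

definition occ :: "(nat \<Rightarrow> 'b) \<Rightarrow> nat set \<Rightarrow> 'b \<Rightarrow> nat" where
  "occ f I x = card {i \<in> I. f i = x}"

lemma occ_union_disjoint:
  assumes "finite I" "finite J" "I \<inter> J = {}"
  shows "occ f (I \<union> J) x = occ f I x + occ f J x"
proof -
  have "{i \<in> I \<union> J. f i = x} = {i \<in> I. f i = x} \<union> {i \<in> J. f i = x}" by auto
  then show ?thesis unfolding occ_def using assms by (auto intro!: card_Un_disjoint)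
qed

lemma occ_interval_split:
  "occ f {b..<b + (l + m)} x = occ f {b..<b + l} x + occ f {b + l..<b + l + m} x"
proof -
  have "{b..<b + (l + m)} = {b..<b + l} \<union> {b + l..<b + l + m}" by auto
  then show ?thesis by (simp add: occ_union_disjoint)
qed

lemma sum_occ:
  assumes "finite I" "finite A" "f ` I \<subseteq> A"
  shows "(\<Sum>x\<in>A. occ f I x) = card I"
proof -
  have "I = (\<Union>x\<in>A. {i \<in> I. f i = x})" using assms(3) by auto
  also have "card \<dots> = (\<Sum>x\<in>A. occ f I x)"
    unfolding occ_def using assms by (intro card_UN_disjoint) auto
  finally show ?thesis by simp
qed

section \<open>Energy decrement along dyadic subdivisions\<close>

text \<open>Divide the sum of squared counts by the squared length. By (u + v)^2 = 2 u^2 + 2 v^2 -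
  (u - v)^2, the value on an interval is the mean of the values on its halves minus at least
  \<open>\<epsilon> / 4\<close>. Starting from the bound 1 at length \<open>L\<close>, each of the
  \<open>m\<close> doublings thus costs \<open>\<epsilon> / 4\<close>. Imbalance is assumed at every
  start \<open>d\<close>, so both halves inherit it directly.\<close>

lemma energy_bound:
  fixes f :: "nat \<Rightarrow> 'b" and \<epsilon> :: real
  assumes "finite A" "f ` {b..<b + 2 ^ m * L} \<subseteq> A"
    and unbalanced: "\<And>j d. \<lbrakk>j < m; b \<le> d; d + 2 ^ Suc j * L \<le> b + 2 ^ m * L\<rbrakk> \<Longrightarrow>
      \<epsilon> * (2 ^ j * real L)\<^sup>2 \<le> (\<Sum>x\<in>A. (real (occ f {d..<d + 2 ^ j * L} x)
          - real (occ f {d + 2 ^ j * L..<d + 2 ^ j * L + 2 ^ j * L} x))\<^sup>2)"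
  shows "(\<Sum>x\<in>A. (real (occ f {b..<b + 2 ^ m * L} x))\<^sup>2)
    \<le> (2 ^ m * real L)\<^sup>2 * (1 - real m * \<epsilon> / 4)"
  using assms(2,3)
proof (induction m arbitrary: b)
  case 0
  \<comment> \<open>One factor of each square is bounded by \<open>L\<close>; the remaining counts
    add up to \<open>L\<close>.\<close>
  have "(\<Sum>x\<in>A. (real (occ f {b..<b + L} x))\<^sup>2) \<le> (\<Sum>x\<in>A. real L * real (occ f {b..<b + L} x))"
  proof (rule sum_mono)
    fix x
    have "occ f {b..<b + L} x \<le> card {b..<b + L}"
      unfolding occ_def by (rule card_mono) auto
    then show "(real (occ f {b..<b + L} x))\<^sup>2 \<le> real L * real (occ f {b..<b + L} x)"
      by (simp add: power2_eq_square mult_right_mono)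
  qed
  also have "\<dots> = real L * real (\<Sum>x\<in>A. occ f {b..<b + L} x)"
    by (simp add: sum_distrib_left)
  also have "(\<Sum>x\<in>A. occ f {b..<b + L} x) = L"
    using sum_occ[of "{b..<b + L}" A f] 0(1) assms(1) by simp
  finally show ?case by (simp add: power2_eq_square)
next
  case (Suc m)
  define l where "l = 2 ^ m * L"
  have twice: "2 ^ Suc m * L = l + l" by (simp add: l_def)
  define u where "u x = real (occ f {b..<b + l} x)" for x
  define v where "v x = real (occ f {b + l..<b + l + l} x)" for x
  have u: "(\<Sum>x\<in>A. (u x)\<^sup>2) \<le> (2 ^ m * real L)\<^sup>2 * (1 - real m * \<epsilon> / 4)"
    unfolding u_def l_def
  proof (rule Suc.IH)
    show "f ` {b..<b + 2 ^ m * L} \<subseteq> A" using Suc.prems(1) by auto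
    fix j d assume "j < m" "b \<le> d" "d + 2 ^ Suc j * L \<le> b + 2 ^ m * L"
    then show "\<epsilon> * (2 ^ j * real L)\<^sup>2 \<le> (\<Sum>x\<in>A. (real (occ f {d..<d + 2 ^ j * L} x)
          - real (occ f {d + 2 ^ j * L..<d + 2 ^ j * L + 2 ^ j * L} x))\<^sup>2)"
      by (intro Suc.prems(2)) auto
  qed
  have v: "(\<Sum>x\<in>A. (v x)\<^sup>2) \<le> (2 ^ m * real L)\<^sup>2 * (1 - real m * \<epsilon> / 4)"
    unfolding v_def l_def
  proof (rule Suc.IH)
    show "f ` {b + 2 ^ m * L..<b + 2 ^ m * L + 2 ^ m * L} \<subseteq> A" using Suc.prems(1) by auto
    fix j d assume "j < m" "b + 2 ^ m * L \<le> d" "d + 2 ^ Suc j * L \<le> b + 2 ^ m * L + 2 ^ m * L"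
    then show "\<epsilon> * (2 ^ j * real L)\<^sup>2 \<le> (\<Sum>x\<in>A. (real (occ f {d..<d + 2 ^ j * L} x)
          - real (occ f {d + 2 ^ j * L..<d + 2 ^ j * L + 2 ^ j * L} x))\<^sup>2)"
      by (intro Suc.prems(2)) auto
  qed
  have uv: "\<epsilon> * (2 ^ m * real L)\<^sup>2 \<le> (\<Sum>x\<in>A. (u x - v x)\<^sup>2)"
    unfolding u_def v_def l_def by (rule Suc.prems(2)) auto
  have "(\<Sum>x\<in>A. (real (occ f {b..<b + 2 ^ Suc m * L} x))\<^sup>2) = (\<Sum>x\<in>A. (u x + v x)\<^sup>2)"
    unfolding twice occ_interval_split u_def v_def by simp
  also have "\<dots> = (\<Sum>x\<in>A. 2 * (u x)\<^sup>2 + 2 * (v x)\<^sup>2 - (u x - v x)\<^sup>2)"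
    by (intro sum.cong) (auto simp: power2_eq_square algebra_simps)
  also have "\<dots> = 2 * (\<Sum>x\<in>A. (u x)\<^sup>2) + 2 * (\<Sum>x\<in>A. (v x)\<^sup>2) - (\<Sum>x\<in>A. (u x - v x)\<^sup>2)"
    by (simp add: sum.distrib sum_subtractf sum_distrib_left)
  \<comment> \<open>Doubling the length multiplies the squared length by 4, so subtracting
    \<open>\<epsilon>\<close> times the old square lowers the factor by
    \<open>\<epsilon> / 4\<close>.\<close>
  also have "\<dots> \<le> 4 * ((2 ^ m * real L)\<^sup>2 * (1 - real m * \<epsilon> / 4)) - \<epsilon> * (2 ^ m * real L)\<^sup>2"
    using u v uv by linarith
  also have "\<dots> = (2 ^ Suc m * real L)\<^sup>2 * (1 - real (Suc m) * \<epsilon> / 4)"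
    by (simp add: power2_eq_square algebra_simps)
  finally show ?case .
qed

section \<open>Choosing positions to delete\<close>

definition separated :: "nat set \<Rightarrow> bool" where
  "separated D \<longleftrightarrow> (\<forall>i. \<not> (i \<in> D \<and> Suc i \<in> D))"

text \<open>Greedy choice, one position at a time: every chosen position blocks at most three
  positions, and each letter occurs at least three times as often as the total demand, so a free
  occurrence always remains.\<close>

lemma separated_selection:
  fixes f :: "nat \<Rightarrow> 'b" and d :: "'b \<Rightarrow> nat"
  assumes "finite I" "finite A"
    and "\<And>x. x \<in> A \<Longrightarrow> 3 * (\<Sum>y\<in>A. d y) \<le> occ f I x"
  shows "\<exists>D \<subseteq> I. separated D \<and> f ` D \<subseteq> A \<and> (\<forall>x\<in>A. occ f D x = d x)"
  using assms(3)
proof (induction "\<Sum>y\<in>A. d y" arbitrary: d)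
  case 0
  then have "\<forall>x\<in>A. d x = 0" using assms(2) by simp
  then show ?case by (intro exI[of _ "{}"]) (auto simp: separated_def occ_def)
next
  case (Suc n)
  have "\<exists>x\<in>A. d x \<noteq> 0"
  proof (rule ccontr)
    assume "\<not> (\<exists>x\<in>A. d x \<noteq> 0)"
    then have "(\<Sum>y\<in>A. d y) = 0" by simp
    with Suc.hyps(2) show False by simp
  qed
  then obtain x where x: "x \<in> A" "d x \<noteq> 0" by blast
  \<comment> \<open>Lower the demand for \<open>x\<close> by one, meet the reduced demand by
    induction, then add one more occurrence of \<open>x\<close>.\<close>
  define e where "e = d(x := d x - 1)"
  have "(\<Sum>y\<in>A. d y) = d x + (\<Sum>y\<in>A - {x}. d y)" using x assms(2) by (simp add: sum.remove)
  moreover have "(\<Sum>y\<in>A. e y) = e x + (\<Sum>y\<in>A - {x}. e y)" using x assms(2) by (simp add: sum.remove)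
  moreover have "(\<Sum>y\<in>A - {x}. e y) = (\<Sum>y\<in>A - {x}. d y)" by (intro sum.cong) (auto simp: e_def)
  ultimately have e: "n = (\<Sum>y\<in>A. e y)" using x Suc.hyps(2) by (simp add: e_def)
  have "\<exists>D \<subseteq> I. separated D \<and> f ` D \<subseteq> A \<and> (\<forall>x\<in>A. occ f D x = e x)"
  proof (rule Suc.hyps(1)[OF e])
    fix y assume "y \<in> A"
    from Suc.prems[OF this] show "3 * (\<Sum>y\<in>A. e y) \<le> occ f I y"
      using Suc.hyps(2) e by simp
  qed
  then obtain D where D: "D \<subseteq> I" "separated D" "f ` D \<subseteq> A" "\<forall>x\<in>A. occ f D x = e x" by blast
  have fin: "finite D" using D(1) assms(1) finite_subset by blast
  have "card D = n" using sum_occ[OF fin assms(2) D(3)] D(4) e by simp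
  \<comment> \<open>Chosen positions and their neighbours on both sides are blocked. For position 0,
    \<open>i - 1\<close> is 0 again, which is blocked already.\<close>
  then have "card (D \<union> (Suc ` D \<union> (\<lambda>i. i - 1) ` D)) \<le> n + (n + n)"
    using card_Un_le[of D "Suc ` D \<union> (\<lambda>i. i - 1) ` D"] card_Un_le[of "Suc ` D" "(\<lambda>i. i - 1) ` D"]
      card_image_le[OF fin, of Suc] card_image_le[OF fin, of "\<lambda>i. i - 1"] by linarith
  also have "\<dots> < card {i \<in> I. f i = x}"
    using Suc.prems[OF x(1)] Suc.hyps(2) by (simp add: occ_def)
  finally have "\<not> {i \<in> I. f i = x} \<subseteq> D \<union> (Suc ` D \<union> (\<lambda>i. i - 1) ` D)"
    using card_mono[of "D \<union> (Suc ` D \<union> (\<lambda>i. i - 1) ` D)" "{i \<in> I. f i = x}"] fin by auto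
  then obtain i where i: "i \<in> I" "f i = x" "i \<notin> D" "i \<notin> Suc ` D" "i \<notin> (\<lambda>i. i - 1) ` D" by blast
  have "Suc i \<notin> D" using i(5) by force
  then have sep: "separated (insert i D)" using D(2) i(3,4) by (auto simp: separated_def)
  have "occ f (insert i D) y = d y" if "y \<in> A" for y
  proof -
    have "occ f (insert i D) y = occ f {i} y + occ f D y"
      using occ_union_disjoint[of "{i}" D f y] i(3) fin by simp
    moreover have "occ f {i} y = (if y = x then 1 else 0)"
    proof -
      have "{j \<in> {i}. f j = y} = (if y = x then {i} else {})" using i(2) by auto
      then show ?thesis by (simp add: occ_def)
    qed
    ultimately show ?thesis using that D(4) x by (auto simp: e_def)
  qed
  then show ?case using sep D(1,3) i(1,2) x(1) by (intro exI[of _ "insert i D"]) auto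
qed

section \<open>Near squares from balanced adjacent intervals\<close>

text \<open>One set \<open>D\<close> serves both halves, so the deletions are non-adjacent across
  their boundary too. Requiring a survivor in the first half rules out the empty anagram.\<close>

definition has_near_square :: "(nat \<Rightarrow> 'b) \<Rightarrow> nat \<Rightarrow> nat \<Rightarrow> bool" where
  "has_near_square f a n \<longleftrightarrow> (\<exists>b l D. a \<le> b \<and> b + (l + l) \<le> a + n \<and> separated D \<and>
     {b..<b + l} - D \<noteq> {} \<and>
     (\<forall>x. occ f ({b..<b + l} - D) x = occ f ({b + l..<b + l + l} - D) x))"

lemma has_near_square_mono:
  assumes "has_near_square f a n" "a' \<le> a" "a + n \<le> a' + n'"
  shows "has_near_square f a' n'"
  using assms unfolding has_near_square_def by (meson order_trans)

lemma occ_Diff: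
  assumes "finite I"
  shows "occ f (I - D) x = occ f I x - occ f (I \<inter> D) x"
proof -
  have "{i \<in> I - D. f i = x} = {i \<in> I. f i = x} - {i \<in> I \<inter> D. f i = x}" by auto
  then show ?thesis unfolding occ_def using assms by (auto intro!: card_Diff_subset)
qed

text \<open>Deleting from each half its surplus of every letter leaves the smaller of the two counts
  in both. The surpluses total at most \<open>card A * \<eta>\<close>, and the density assumption is
  three times this, as the greedy selection requires.\<close>

lemma near_square_if_balanced:
  fixes f :: "nat \<Rightarrow> 'b" and \<eta> :: real
  assumes A: "finite A" "A \<noteq> {}" "f ` {b..<b + (l + l)} \<subseteq> A"
    and close: "\<And>x. x \<in> A \<Longrightarrow>
      \<bar>real (occ f {b..<b + l} x) - real (occ f {b + l..<b + l + l} x)\<bar> \<le> \<eta>"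
    and dense: "\<And>x. x \<in> A \<Longrightarrow> 3 * card A * \<eta> \<le> occ f {b..<b + l} x"
      "\<And>x. x \<in> A \<Longrightarrow> 3 * card A * \<eta> \<le> occ f {b + l..<b + l + l} x"
    and pos: "l > 0"
  shows "has_near_square f b (l + l)"
proof -
  define I where "I = {b..<b + l}"
  define J where "J = {b + l..<b + l + l}"
  define u where "u x = occ f I x" for x
  define v where "v x = occ f J x" for x
  have fin: "finite I" "finite J" by (auto simp: I_def J_def)
  \<comment> \<open>Tagging letters with their half lets one selection serve both halves, so that the deleted
    positions are non-adjacent across the common boundary too.\<close>
  define g where "g i = (i < b + l, f i)" for i
  \<comment> \<open>Truncated subtraction makes the demand 0 in the half that has fewer occurrences
    of the letter.\<close>
  define d where "d y = (if fst y then u (snd y) - v (snd y) else v (snd y) - u (snd y))" for y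
  have IJ: "i \<in> I \<Longrightarrow> i < b + l" "i \<in> J \<Longrightarrow> \<not> i < b + l" for i by (auto simp: I_def J_def)
  have occI: "occ g (S \<inter> (I \<union> J)) (True, x) = occ f (S \<inter> I) x" for S x
    unfolding occ_def g_def by (rule arg_cong[where f = card]) (use IJ in auto)
  have occJ: "occ g (S \<inter> (I \<union> J)) (False, x) = occ f (S \<inter> J) x" for S x
    unfolding occ_def g_def by (rule arg_cong[where f = card]) (use IJ in auto)
  have "(\<Sum>y\<in>UNIV \<times> A. d y) = (\<Sum>s\<in>UNIV. \<Sum>x\<in>A. d (s, x))"
    by (simp add: sum.cartesian_product)
  \<comment> \<open>At most one of the two truncated differences is nonzero, so each summand is the
    absolute difference of the counts.\<close>
  also have "\<dots> = (\<Sum>x\<in>A. (u x - v x) + (v x - u x))"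
    by (simp add: UNIV_bool d_def sum.distrib)
  finally have "real (\<Sum>y\<in>UNIV \<times> A. d y) = (\<Sum>x\<in>A. real ((u x - v x) + (v x - u x)))"
    by simp
  also have "\<dots> \<le> (\<Sum>x\<in>A. \<eta>)"
  proof (rule sum_mono)
    fix x assume "x \<in> A"
    from close[OF this] show "real ((u x - v x) + (v x - u x)) \<le> \<eta>"
      by (cases "u x \<le> v x") (auto simp: u_def v_def I_def J_def)
  qed
  finally have total: "real (\<Sum>y\<in>UNIV \<times> A. d y) \<le> card A * \<eta>" by simp
  have enough: "3 * (\<Sum>y\<in>UNIV \<times> A. d y) \<le> u x" "3 * (\<Sum>y\<in>UNIV \<times> A. d y) \<le> v x" if "x \<in> A" for x
  proof -
    have "real (3 * (\<Sum>y\<in>UNIV \<times> A. d y)) \<le> 3 * card A * \<eta>" using total by simp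
    then show "3 * (\<Sum>y\<in>UNIV \<times> A. d y) \<le> u x" "3 * (\<Sum>y\<in>UNIV \<times> A. d y) \<le> v x"
      using dense[OF that] unfolding u_def v_def I_def J_def by linarith+
  qed
  have "\<exists>D \<subseteq> I \<union> J. separated D \<and> g ` D \<subseteq> UNIV \<times> A \<and> (\<forall>y\<in>UNIV \<times> A. occ g D y = d y)"
  proof (rule separated_selection)
    fix y :: "bool \<times> 'b" assume y: "y \<in> UNIV \<times> A"
    have "occ g (I \<union> J) y = (if fst y then u (snd y) else v (snd y))"
      using occI[of UNIV "snd y"] occJ[of UNIV "snd y"]
      by (cases y; cases "fst y") (auto simp: u_def v_def)
    then show "3 * (\<Sum>y\<in>UNIV \<times> A. d y) \<le> occ g (I \<union> J) y"
      using enough[of "snd y"] y by (auto simp: mem_Times_iff)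
  qed (use fin A in auto)
  then obtain D where D: "D \<subseteq> I \<union> J" "separated D" "\<forall>y\<in>UNIV \<times> A. occ g D y = d y"
    by blast
  have "D \<inter> (I \<union> J) = D" using D(1) by auto
  then have occD: "occ f (I \<inter> D) x = u x - v x" "occ f (J \<inter> D) x = v x - u x" if "x \<in> A" for x
    using that D(3) occI[of D x] occJ[of D x] by (auto simp: d_def Int_commute)
  have eq: "occ f (I - D) x = occ f (J - D) x" for x
  proof (cases "x \<in> A")
    case True
    then show ?thesis using occD[OF True] fin by (simp add: occ_Diff flip: u_def v_def)
  next
    case False
    have "f ` (I \<union> J) \<subseteq> A" using A(3) by (auto simp: I_def J_def)
    then have "{i \<in> I - D. f i = x} = {}" "{i \<in> J - D. f i = x} = {}" using False by auto
    then show ?thesis by (simp only: occ_def)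
  qed
  \<comment> \<open>The letter at \<open>b\<close> occurs in the first half, and at most a third of
    its occurrences there are deleted.\<close>
  have ne: "I - D \<noteq> {}"
  proof
    assume sub: "I - D = {}"
    obtain x where x: "x \<in> A" "f b = x" using A(3) pos by force
    have "b \<in> {i \<in> I. f i = x}" using pos x by (auto simp: I_def)
    then have "u x > 0" unfolding u_def occ_def using fin card_gt_0_iff by fastforce
    have "u x - v x \<le> (\<Sum>y\<in>UNIV \<times> A. d y)"
      using member_le_sum[of "(True, x)" "UNIV \<times> A" d] A x by (simp add: d_def)
    moreover have "occ f (I - D) x = 0" unfolding sub by (simp add: occ_def)
    then have "u x \<le> u x - v x" using occD[OF x(1)] fin by (simp add: occ_Diff flip: u_def)
    ultimately show False using enough[OF x(1)] \<open>u x > 0\<close> by linarith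
  qed
  show ?thesis unfolding has_near_square_def
    using eq ne D(2) unfolding I_def J_def by blast
qed

section \<open>Recurrent letters and the induction on the alphabet size\<close>

text \<open>The interval splits into \<open>j\<close> disjoint windows of length \<open>L\<close>,
  each contributing an occurrence.\<close>

lemma occ_ge_if_syndetic:
  assumes "\<And>d. b \<le> d \<Longrightarrow> d + L \<le> b + j * L \<Longrightarrow> x \<in> f ` {d..<d + L}"
  shows "j \<le> occ f {b..<b + j * L} x"
  using assms
proof (induction j)
  case (Suc j)
  have "j \<le> occ f {b..<b + j * L} x" by (rule Suc.IH, rule Suc.prems) auto
  moreover have "x \<in> f ` {b + j * L..<b + j * L + L}" by (rule Suc.prems) auto
  then have "occ f {b + j * L..<b + j * L + L} x > 0"
    unfolding occ_def by (fastforce simp: card_gt_0_iff)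
  ultimately show ?case
    using occ_interval_split[of f b "j * L" L x] by (simp add: add.commute)
qed simp

text \<open>The length \<open>n\<close> depends on \<open>k\<close> alone, because the induction
  hypothesis is applied to windows at every position and to every alphabet \<open>A - {x}\<close>.
  In a word without near squares no such window can miss a letter, and every pair of adjacent
  intervals considered is unbalanced, which would push the sum of squares below 0.\<close>

lemma near_square_unavoidable:
  "\<exists>n. \<forall>(A :: 'b set) f a. finite A \<and> card A \<le> k \<and> f ` {a..<a + n} \<subseteq> A \<longrightarrow> has_near_square f a n"
proof (induction k)
  case 0
  show ?case
  proof (intro exI[of _ 1] allI impI)
    fix A :: "'b set" and f and a :: nat
    assume "finite A \<and> card A \<le> 0 \<and> f ` {a..<a + 1} \<subseteq> A"
    then have "A = {}" "f a \<in> A" by auto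
    then show "has_near_square f a 1" by simp
  qed
next
  case (Suc k)
  from Suc.IH obtain L where "\<forall>(A :: 'b set) f a. finite A \<and> card A \<le> k \<and>
      f ` {a..<a + L} \<subseteq> A \<longrightarrow> has_near_square f a L" by (rule exE)
  then have L: "has_near_square f a L"
    if "finite A" "card A \<le> k" "f ` {a..<a + L} \<subseteq> A" for A :: "'b set" and f a
    using that by simp
  \<comment> \<open>The empty word over the empty alphabet satisfies the premises of
    \<open>L\<close>, yet a near square has a surviving position.\<close>
  have "L > 0"
  proof (rule ccontr)
    assume "\<not> L > 0"
    then show False using L[of "{}" undefined 0] by (auto simp: has_near_square_def)
  qed
  \<comment> \<open>Chosen so that, for \<open>l = 2 ^ j * L\<close>, three times the total surplus
    is at most \<open>2 ^ j\<close>, the number of occurrences that the windows guarantee.\<close>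
  define \<delta> :: real where "\<delta> = 1 / (3 * Suc k * L)"
  have "\<delta> > 0" using \<open>L > 0\<close> by (simp add: \<delta>_def)
  \<comment> \<open>Enough doublings to make the factor \<open>1 - m * \<epsilon> / 4\<close> of the
    energy bound negative for \<open>\<epsilon> = \<delta>\<^sup>2\<close>.\<close>
  obtain m :: nat where "4 / \<delta>\<^sup>2 < real m" using reals_Archimedean2 by blast
  then have m: "1 < real m * \<delta>\<^sup>2 / 4" using \<open>\<delta> > 0\<close> by (simp add: field_simps)
  show ?case
  proof (intro exI[of _ "2 ^ m * L"] allI impI, elim conjE)
    fix A :: "'b set" and f a
    assume A: "finite A" "card A \<le> Suc k" "f ` {a..<a + 2 ^ m * L} \<subseteq> A"
    show "has_near_square f a (2 ^ m * L)"
    proof (rule ccontr)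
      assume none: "\<not> has_near_square f a (2 ^ m * L)"
      have window: "x \<in> f ` {d..<d + L}" if "x \<in> A" "a \<le> d" "d + L \<le> a + 2 ^ m * L" for x d
      proof (rule ccontr)
        assume "x \<notin> f ` {d..<d + L}"
        moreover have "f ` {d..<d + L} \<subseteq> A" using A(3) that by auto
        ultimately have "f ` {d..<d + L} \<subseteq> A - {x}" by blast
        moreover have "card (A - {x}) \<le> k" using A that by simp
        ultimately have "has_near_square f d L" using A(1) by (intro L) auto
        then show False using has_near_square_mono none that by blast
      qed
      have "A \<noteq> {}" using A(3) \<open>L > 0\<close> by auto
      have "(\<Sum>x\<in>A. (real (occ f {a..<a + 2 ^ m * L} x))\<^sup>2)
          \<le> (2 ^ m * real L)\<^sup>2 * (1 - real m * \<delta>\<^sup>2 / 4)"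
      \<comment> \<open>A pair of intervals violating the imbalance assumption is balanced enough to
        yield a near square.\<close>
      proof (rule energy_bound[OF A(1,3)], rule ccontr)
        fix j d
        assume j: "j < m" "a \<le> d" "d + 2 ^ Suc j * L \<le> a + 2 ^ m * L"
        define l where "l = 2 ^ j * L"
        define u where "u x = real (occ f {d..<d + l} x)" for x
        define v where "v x = real (occ f {d + l..<d + l + l} x)" for x
        have fits: "d + (l + l) \<le> a + 2 ^ m * L" using j(3) by (simp add: l_def)
        assume "\<not> \<delta>\<^sup>2 * (2 ^ j * real L)\<^sup>2 \<le> (\<Sum>x\<in>A. (real (occ f {d..<d + 2 ^ j * L} x)
          - real (occ f {d + 2 ^ j * L..<d + 2 ^ j * L + 2 ^ j * L} x))\<^sup>2)"
        then have less: "(\<Sum>x\<in>A. (u x - v x)\<^sup>2) < (\<delta> * l)\<^sup>2"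
          by (simp add: u_def v_def l_def power_mult_distrib)
        have close: "\<bar>u x - v x\<bar> \<le> \<delta> * l" if "x \<in> A" for x
        proof -
          have "(u x - v x)\<^sup>2 \<le> (\<Sum>x\<in>A. (u x - v x)\<^sup>2)"
            using that A(1) by (intro member_le_sum) auto
          then have "\<bar>u x - v x\<bar>\<^sup>2 \<le> (\<delta> * l)\<^sup>2" using less by simp
          then show ?thesis using \<open>\<delta> > 0\<close> by (intro power2_le_imp_le[of "\<bar>u x - v x\<bar>"]) auto
        qed
        have "3 * card A * (\<delta> * l) \<le> 3 * Suc k * (\<delta> * l)"
          using A(2) \<open>\<delta> > 0\<close> by (intro mult_right_mono) auto
        also have "\<dots> = real (3 * Suc k * L) * \<delta> * 2 ^ j" by (simp add: l_def mult_ac)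
        also have "real (3 * Suc k * L) * \<delta> = 1" using \<open>L > 0\<close> unfolding \<delta>_def by (simp del: of_nat_mult)
        finally have small: "3 * card A * (\<delta> * l) \<le> 2 ^ j" by simp
        have occ: "2 ^ j \<le> real (occ f {e..<e + l} x)" if "x \<in> A" "a \<le> e" "e + l \<le> a + 2 ^ m * L" for x e
        proof -
          have "2 ^ j \<le> occ f {e..<e + l} x"
            unfolding l_def using that by (intro occ_ge_if_syndetic window) (auto simp: l_def)
          then have "real (2 ^ j) \<le> real (occ f {e..<e + l} x)" by (rule of_nat_mono)
          then show ?thesis by simp
        qed
        have "has_near_square f d (l + l)"
        proof (rule near_square_if_balanced[OF A(1) \<open>A \<noteq> {}\<close>])
          show "f ` {d..<d + (l + l)} \<subseteq> A" using A(3) fits j(2) by auto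
          show "l > 0" using \<open>L > 0\<close> by (simp add: l_def)
          fix x assume x: "x \<in> A"
          show "\<bar>real (occ f {d..<d + l} x) - real (occ f {d + l..<d + l + l} x)\<bar> \<le> \<delta> * l"
            using close[OF x] by (simp add: u_def v_def)
          show "3 * card A * (\<delta> * l) \<le> occ f {d..<d + l} x"
            by (rule order_trans[OF small occ[OF x]]) (use fits j(2) in auto)
          show "3 * card A * (\<delta> * l) \<le> occ f {d + l..<d + l + l} x"
            by (rule order_trans[OF small occ[OF x]]) (use fits j(2) in auto)
        qed
        then show False using has_near_square_mono[OF _ j(2) fits] none by blast
      qed
      moreover have "(2 ^ m * real L)\<^sup>2 * (1 - real m * \<delta>\<^sup>2 / 4) < 0"
        using m \<open>L > 0\<close> by (intro mult_pos_neg) auto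
      moreover have "0 \<le> (\<Sum>x\<in>A. (real (occ f {a..<a + 2 ^ m * L} x))\<^sup>2)" by (intro sum_nonneg) auto
      ultimately show False by linarith
    qed
  qed
qed

section \<open>The square of a path and its pathwidth\<close>

text \<open>Two additive inequalities express distance at most 2 without truncated
  subtraction.\<close>

definition path_square :: "nat \<Rightarrow> nat pair_pre_digraph" where
  "path_square n = \<lparr>pverts = {0..<n},
     parcs = {(u, v). u < n \<and> v < n \<and> u \<noteq> v \<and> u \<le> v + 2 \<and> v \<le> u + 2}\<rparr>"

lemma pair_graph_path_square: "pair_graph (path_square n)"
proof
  have "parcs (path_square n) \<subseteq> {0..<n} \<times> {0..<n}" by (auto simp: path_square_def)
  then show "finite (parcs (path_square n))" by (rule finite_subset) simp
qed (auto simp: path_square_def symmetric_def intro!: symI)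

lemma parcs_path_square:
  "parcs (path_square n) = {(u, v). u < n \<and> v < n \<and> u \<noteq> v \<and> u \<le> v + 2 \<and> v \<le> u + 2}"
  by (simp add: path_square_def)

text \<open>Helly property of intervals: each edge of the triangle lies in some bag. Of these three
  bags, the one with the middle index contains its own edge, and also the third vertex, which lies
  in both outer bags. So some bag has at least three elements.\<close>

lemma pathwidth_ge_triangle:
  assumes G: "path_decomposition G Bs" "finite (verts G)"
    and uvw: "distinct [u, v, w]" "(u, v) \<in> arcs_ends G" "(v, w) \<in> arcs_ends G" "(u, w) \<in> arcs_ends G"
  shows "2 \<le> decomposition_width Bs"
proof -
  have edge: "\<exists>i < length Bs. x \<in> Bs ! i \<and> y \<in> Bs ! i" if "(x, y) \<in> arcs_ends G" for x y
    using G(1) that unfolding path_decomposition_def by (fastforce simp: in_set_conv_nth)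
  have mid: "x \<in> Bs ! j" if "i \<le> j" "j \<le> k" "k < length Bs" "x \<in> Bs ! i" "x \<in> Bs ! k" for x i j k
    using G(1) that unfolding path_decomposition_def by blast
  obtain i where i: "i < length Bs" "u \<in> Bs ! i" "v \<in> Bs ! i" using edge[OF uvw(2)] by blast
  obtain j where j: "j < length Bs" "v \<in> Bs ! j" "w \<in> Bs ! j" using edge[OF uvw(3)] by blast
  obtain k where k: "k < length Bs" "u \<in> Bs ! k" "w \<in> Bs ! k" using edge[OF uvw(4)] by blast
  have "\<exists>B \<in> set Bs. {u, v, w} \<subseteq> B"
  proof -
    consider "i \<le> j \<and> j \<le> k \<or> k \<le> j \<and> j \<le> i" | "j \<le> i \<and> i \<le> k \<or> k \<le> i \<and> i \<le> j"
      | "i \<le> k \<and> k \<le> j \<or> j \<le> k \<and> k \<le> i" by linarith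
    then show ?thesis
    proof cases
      case 1
      then have "u \<in> Bs ! j" using mid i j k by blast
      then show ?thesis using j nth_mem by blast
    next
      case 2
      then have "w \<in> Bs ! i" using mid i j k by blast
      then show ?thesis using i nth_mem by blast
    next
      case 3
      then have "v \<in> Bs ! k" using mid i j k by blast
      then show ?thesis using k nth_mem by blast
    qed
  qed
  then obtain B where B: "B \<in> set Bs" "{u, v, w} \<subseteq> B" by blast
  have "B \<subseteq> verts G" using B(1) G(1) by (auto simp: path_decomposition_def)
  then have "card {u, v, w} \<le> card B" using B(2) G(2) finite_subset card_mono by metis
  moreover have "card B \<le> Max (card ` set Bs)" using B(1) by (intro Max_ge) auto
  ultimately show ?thesis using uvw(1) by (simp add: decomposition_width_def)
qed

lemma pathwidth_path_square:
  assumes "n \<ge> 3"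
  shows "pathwidth (with_proj (path_square n)) = 2"
proof (rule antisym)
  let ?G = "with_proj (path_square n)"
  define Bs where "Bs = map (\<lambda>i. {i, i + 1, i + 2}) [0..<n - 2]"
  have set_Bs: "set Bs = (\<lambda>i. {i, i + 1, i + 2}) ` {0..<n - 2}" by (simp add: Bs_def)
  have verts: "verts ?G = {0..<n}" by (simp add: path_square_def)
  \<comment> \<open>The case \<open>u = v\<close> is included so that the same fact covers the
    vertices.\<close>
  have cover: "\<exists>B \<in> set Bs. u \<in> B \<and> v \<in> B" if "u \<le> v" "v \<le> u + 2" "v < n" for u v
  proof -
    \<comment> \<open>The last bag starts at \<open>n - 3\<close>, so it must also serve the pairs
      starting at \<open>n - 2\<close> or \<open>n - 1\<close>.\<close>
    define i where "i = min u (n - 3)"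
    have "i \<in> {0..<n - 2}" using assms by (auto simp: i_def)
    moreover have "u \<in> {i, i + 1, i + 2}" "v \<in> {i, i + 1, i + 2}"
      using that assms by (auto simp: i_def)
    ultimately show ?thesis unfolding set_Bs by (intro bexI[of _ "{i, i + 1, i + 2}"] conjI image_eqI[of _ _ i]) simp_all
  qed
  have "path_decomposition ?G Bs"
    unfolding path_decomposition_def
  proof (intro conjI allI impI)
    show "Bs \<noteq> []" using assms by (simp add: Bs_def)
    have "{0..<n} \<subseteq> \<Union> (set Bs)"
    proof
      fix u assume "u \<in> {0..<n}"
      then show "u \<in> \<Union> (set Bs)" using cover[of u u] by auto
    qed
    moreover have "\<Union> (set Bs) \<subseteq> {0..<n}" unfolding set_Bs by auto
    ultimately show "\<Union> (set Bs) = verts ?G" unfolding verts by blast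
    show "\<forall>(u, v)\<in>arcs_ends ?G. \<exists>B\<in>set Bs. u \<in> B \<and> v \<in> B"
    proof (clarsimp simp: parcs_path_square)
      fix u v assume "u < n" "v < n" "u \<le> Suc (Suc v)" "v \<le> Suc (Suc u)"
      then show "\<exists>B\<in>set Bs. u \<in> B \<and> v \<in> B" using cover[of u v] cover[of v u] by (cases "u \<le> v") auto
    qed
    fix i j k assume "i \<le> j \<and> j \<le> k \<and> k < length Bs"
    \<comment> \<open>A common vertex x of the outer bags satisfies k \<le> x \<le> i + 2, hence j
      \<le> x \<le> j + 2.\<close>
    then show "Bs ! i \<inter> Bs ! k \<subseteq> Bs ! j" by (auto simp: Bs_def)
  qed
  then have "pathwidth ?G \<le> decomposition_width Bs" by (rule pathwidth_le)
  also have "card ` set Bs = {3}"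
  proof -
    have "card {i, i + 1, i + 2} = 3" for i :: nat by simp
    moreover have "{0..<n - 2} \<noteq> {}" using assms by simp
    ultimately show ?thesis unfolding set_Bs image_image by (simp only: image_constant_conv if_False)
  qed
  then have "decomposition_width Bs = 2" by (simp add: decomposition_width_def)
  finally show "pathwidth ?G \<le> 2" .
  interpret pair_graph "path_square n" by (rule pair_graph_path_square)
  obtain Bs' where Bs': "path_decomposition ?G Bs'" "decomposition_width Bs' = pathwidth ?G"
    using pathwidth_attained wf_digraph_wp_iff by (metis wf_digraph_axioms)
  show "2 \<le> pathwidth ?G"
    unfolding Bs'(2)[symmetric]
    by (rule pathwidth_ge_triangle[OF Bs'(1), of 0 1 2])
      (use assms in \<open>auto simp: parcs_path_square verts\<close>)
qed

section \<open>From near squares to anagrams on paths\<close>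

text \<open>As \<open>D\<close> never contains two consecutive numbers, the survivor following
  \<open>a\<close> is \<open>Suc a\<close> or \<open>Suc (Suc a)\<close>, both adjacent to
  \<open>a\<close>. Survivors are listed in increasing order, so no vertex repeats.\<close>

lemma vpath_filter_upt:
  assumes "separated D" "b \<le> n" "filter (\<lambda>i. i \<notin> D) [a..<b] \<noteq> []"
  shows "vpath (filter (\<lambda>i. i \<notin> D) [a..<b]) (with_proj (path_square n))"
proof -
  let ?G = "with_proj (path_square n)"
  have "set (vwalk_arcs (filter (\<lambda>i. i \<notin> D) [a..<b])) \<subseteq> arcs_ends ?G"
  proof (induction "b - a" arbitrary: a)
    case (Suc m)
    then have "a < b" by simp
    let ?p = "filter (\<lambda>i. i \<notin> D) [Suc a..<b]"
    have IH: "set (vwalk_arcs ?p) \<subseteq> arcs_ends ?G" using Suc by simp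
    have "(a, hd ?p) \<in> arcs_ends ?G" if "a \<notin> D" "?p \<noteq> []"
    proof -
      have ab: "Suc a < b" using that(2) by (cases "Suc a < b") auto
      show ?thesis
      proof (cases "Suc a \<in> D")
        case False
        then show ?thesis using ab assms(2) by (simp add: upt_conv_Cons parcs_path_square)
      next
        case True
        then have "Suc (Suc a) \<notin> D" using assms(1) by (auto simp: separated_def)
        moreover have "Suc (Suc a) < b"
          using that(2) True ab by (cases "Suc (Suc a) < b") (auto simp: upt_conv_Cons)
        ultimately show ?thesis
          using True ab assms(2) by (simp add: upt_conv_Cons parcs_path_square)
      qed
    qed
    then show ?case using IH \<open>a < b\<close> by (cases ?p) (auto simp: upt_conv_Cons)
  qed simp
  then show ?thesis using assms(2,3) by (auto simp: vpath_def vwalk_def path_square_def)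
qed

lemma count_mset_map_filter_upt:
  "count (mset (map f (filter P [a..<b]))) x = occ f {i \<in> {a..<b}. P i} x"
proof -
  have "count (mset (map f (filter P [a..<b]))) x = length (filter (\<lambda>i. f i = x) (filter P [a..<b]))"
    by (induction b) (auto simp: upt_conv_Cons)
  also have "\<dots> = card (set (filter (\<lambda>i. f i = x) (filter P [a..<b])))"
    by (intro distinct_card[symmetric] distinct_filter distinct_upt)
  also have "set (filter (\<lambda>i. f i = x) (filter P [a..<b])) = {i \<in> {i \<in> {a..<b}. P i}. f i = x}"
    by auto
  finally show ?thesis by (simp add: occ_def)
qed

lemma anagram_if_near_square:
  assumes "has_near_square \<phi> 0 n"
  shows "\<exists>p. vpath p (with_proj (path_square n)) \<and> anagramish (map \<phi> p)"
proof -
  obtain b l D where bl: "b + (l + l) \<le> n" and D: "separated D" and ne: "{b..<b + l} - D \<noteq> {}"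
    and eq: "\<And>x. occ \<phi> ({b..<b + l} - D) x = occ \<phi> ({b + l..<b + l + l} - D) x"
    using assms unfolding has_near_square_def by auto
  define p where "p = filter (\<lambda>i. i \<notin> D) [b..<b + l]"
  define q where "q = filter (\<lambda>i. i \<notin> D) [b + l..<b + l + l]"
  have "[b..<b + (l + l)] = [b..<b + l] @ [b + l..<b + l + l]"
    using upt_add_eq_append[of b "b + l" l] by (simp add: add.assoc)
  then have pq: "filter (\<lambda>i. i \<notin> D) [b..<b + (l + l)] = p @ q" by (simp add: p_def q_def)
  have "set p \<noteq> {}" using ne by (auto simp: p_def)
  then have "p \<noteq> []" by auto
  have mset: "mset (map \<phi> p) = mset (map \<phi> q)"
  proof (rule multiset_eqI)
    fix x
    show "count (mset (map \<phi> p)) x = count (mset (map \<phi> q)) x"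
      using eq[of x] unfolding p_def q_def count_mset_map_filter_upt
      by (simp add: set_diff_eq)
  qed
  \<comment> \<open>Equal lengths put the midpoint of \<open>p @ q\<close> exactly at the boundary
    between the two intervals.\<close>
  then have len: "length p = length q" by (metis length_map size_mset)
  have "anagramish (map \<phi> (p @ q))"
    unfolding anagramish_def using mset len \<open>p \<noteq> []\<close>
    by (intro exI[of _ "length p"]) (auto simp: Suc_le_eq)
  moreover have "vpath (p @ q) (with_proj (path_square n))"
    unfolding pq[symmetric] by (rule vpath_filter_upt[OF D bl]) (use pq \<open>p \<noteq> []\<close> in simp)
  ultimately show ?thesis by blast
qed

theorem theorem1:
  fixes c :: nat
  assumes "c \<ge> 1"
  shows "\<exists>G :: nat pair_pre_digraph.
           pair_graph G \<and>
           pathwidth (with_proj G) = 2 \<and>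
           \<not> (\<exists>\<phi>. anagram_free_colouring (with_proj G) c \<phi>)"
proof -
  obtain m where m: "\<forall>(A :: nat set) f a. finite A \<and> card A \<le> c \<and>
      f ` {a..<a + m} \<subseteq> A \<longrightarrow> has_near_square f a m"
    using near_square_unavoidable[of c] by (rule exE)
  \<comment> \<open>Three extra vertices guarantee a triangle, hence pathwidth 2, whatever
    \<open>m\<close> is; the near square is found among the first \<open>m\<close> vertices.\<close>
  define n where "n = m + 3"
  have "\<not> anagram_free_colouring (with_proj (path_square n)) c \<phi>" for \<phi>
  proof
    assume free: "anagram_free_colouring (with_proj (path_square n)) c \<phi>"
    then have "\<phi> ` {0..<0 + m} \<subseteq> {1..c}"
      by (auto simp: anagram_free_colouring_def path_square_def n_def Pi_iff)
    then have "has_near_square \<phi> 0 m" by (intro m[rule_format, of "{1..c}"]) auto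
    then have "has_near_square \<phi> 0 n" by (rule has_near_square_mono) (auto simp: n_def)
    from anagram_if_near_square[OF this] free show False by (auto simp: anagram_free_colouring_def)
  qed
  moreover have "pathwidth (with_proj (path_square n)) = 2"
    by (rule pathwidth_path_square) (simp add: n_def)
  ultimately show ?thesis using pair_graph_path_square by blast
qed

end
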